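(* Let $C\subset\mathbb{R}^n$ be closed, let $\varphi:\mathbb{R}^n\to\mathbb{R}^l$ be continuous, set $Q:=\varphi(C)$, let $\bar y\in Q$, and let $\Psi:\mathbb{R}^l\rightrightarrows\mathbb{R}^n$ be given by $\Psi(y):=\varphi^{-1}(y)\cap C$ (so $\mathrm{dom}\,\Psi=Q$). Suppose that $\Psi$ is inner semicompact at $\bar y$ with respect to $\mathrm{dom}\,\Psi$. If $\varphi$ is calm at some $\bar x\in\Psi(\bar y)$, then \[T_C(\bar x)\subset\{u : \exists\,v\in T_Q(\bar y)\text{ with } v\in D\varphi(\bar x)u\}.\] On the other hand, if $\Psi$ is inner calm* at $\bar y$ with respect to $\mathrm{dom}\,\Psi$ in the fuzzy sense, then \[T_Q(\bar y)\subset\bigcup_{\bar x\in\Psi(\bar y)}\{v : \exists\,u\in T_C(\bar x)\text{ with } v\in D\varphi(\bar x)u\}.\] Moreover, if there exists $\bar x\in\Psi(\bar y)$ such that $\Psi$ is inner calm at $(\bar y,\bar x)$ with respect to $\mathrm{dom}\,\Psi$, then the last estimate holds with this $\bar x$, i.e., $T_Q(\bar y)\subset\{v:\exists\,u\in T_C(\bar x)\text{ with }v\in D\varphi(\bar x)u\}$.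
   Context: $T_\Omega(\bar z)=\{w:\exists t_k\downarrow0,\,w_k\to w,\ \bar z+t_kw_k\in\Omega\ \forall k\}$ is the tangent (Bouligand) cone. $D\varphi(\bar x)u:=\{v:(u,v)\in T_{\mathrm{gph}\,\varphi}(\bar x,\varphi(\bar x))\}$ is the graphical derivative. A single-valued $\varphi$ is calm at $\bar x$ if there are $\kappa>0$ and a neighbourhood $V$ of $\bar x$ with $\|\varphi(x)-\varphi(\bar x)\|\le\kappa\|x-\bar x\|$ for all $x\in V$. For $S:\mathbb{R}^p\rightrightarrows\mathbb{R}^q$, $\mathrm{dom}\,S=\{y:S(y)\ne\emptyset\}$ and $\Omega\subset\mathbb{R}^p$: - $S$ is inner semicompact at $\bar y$ with respect to $\Omega$ if for every sequence $y_k\to\bar y$ with $y_k\in\Omega$ there exist an infinite $K\subset\mathbb{N}$ and $x_k\in S(y_k)$ ($k\in K$) converging to some $\bar x$; - $S$ is inner calm at $(\bar y,\bar x)\in\mathrm{gph}\,S$ with respect to $\Omega$ if there is $\kappa>0$ such that for every sequence $y_k\to\bar y$ with $y_k\in\Omega$ there exists a sequence $x_k$ with $x_k\in S(y_k)$ and $\|x_k-\bar x\|\le\kappa\|y_k-\bar y\|$ for sufficiently large $k$; - $S$ is inner calm* at $\bar y$ with respect to $\Omega$ in the fuzzy sense if for every unit direction $v$, either $v\notin T_\Omega(\bar y)$, or there exist $\kappa_v>0$, a sequence $y_k\in\Omega$ converging to $\bar y$ from $v$ (i.e. $y_k=\bar y+t_kv_k$ with $t_k\downarrow0$, $v_k\to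 v$), $x_k\in S(y_k)$ and a point $\bar x\in\mathbb{R}^q$ with $\|x_k-\bar x\|\le\kappa_v\|y_k-\bar y\|$ for all $k$. *)

theory Defs
  imports "HOL-Analysis.Analysis"
begin

text \<open>
  Set-valued maps from \<^typ>\<open>'a\<close> to \<^typ>\<open>'b\<close> are functions of type \<^typ>\<open>'a \<Rightarrow> 'b set\<close>.
  Throughout, \<open>t\<^sub>k \<down> 0\<close> is read as: \<open>t\<^sub>k > 0\<close> for all \<open>k\<close> and \<open>t\<^sub>k \<rightarrow> 0\<close>; monotonicity of the
  sequence is not required.
\<close>

definition tangent_cone :: "'a::real_normed_vector set \<Rightarrow> 'a \<Rightarrow> 'a set" where
  "tangent_cone \<Omega> zbar =
    {w. \<exists>(t :: nat \<Rightarrow> real) (ws :: nat \<Rightarrow> 'a).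
          (\<forall>k. t k > 0) \<and> t \<longlonglongrightarrow> 0 \<and> ws \<longlonglongrightarrow> w \<and> (\<forall>k. zbar + t k *\<^sub>R ws k \<in> \<Omega>)}"

definition fun_graph :: "('a \<Rightarrow> 'b) \<Rightarrow> ('a \<times> 'b) set" where
  "fun_graph \<phi> = {(x, y). y = \<phi> x}"

definition graphical_derivative ::
    "('a::real_normed_vector \<Rightarrow> 'b::real_normed_vector) \<Rightarrow> 'a \<Rightarrow> 'a \<Rightarrow> 'b set" where
  "graphical_derivative \<phi> xbar u = {v. (u, v) \<in> tangent_cone (fun_graph \<phi>) (xbar, \<phi> xbar)}"

definition calm_at :: "('a::real_normed_vector \<Rightarrow> 'b::real_normed_vector) \<Rightarrow> 'a \<Rightarrow> bool" where
  "calm_at \<phi> xbar \<longleftrightarrow>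
    (\<exists>\<kappa>>0. \<forall>\<^sub>F x in nhds xbar. norm (\<phi> x - \<phi> xbar) \<le> \<kappa> * norm (x - xbar))"

definition sv_dom :: "('a \<Rightarrow> 'b set) \<Rightarrow> 'a set" where
  "sv_dom S = {y. S y \<noteq> {}}"

text \<open>The infinite index set \<open>K\<close> is given by its increasing enumeration \<open>r\<close>.\<close>

definition inner_semicompact_at ::
    "('a::real_normed_vector \<Rightarrow> 'b::real_normed_vector set) \<Rightarrow> 'a \<Rightarrow> 'a set \<Rightarrow> bool" where
  "inner_semicompact_at S ybar \<Omega> \<longleftrightarrow>
    (\<forall>y :: nat \<Rightarrow> 'a. (\<forall>k. y k \<in> \<Omega>) \<and> y \<longlonglongrightarrow> ybar \<longrightarrow>
      (\<exists>(r :: nat \<Rightarrow> nat) (x :: nat \<Rightarrow> 'b) xbar.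
         strict_mono r \<and> (\<forall>k. x k \<in> S (y (r k))) \<and> x \<longlonglongrightarrow> xbar))"

definition inner_calm_at ::
    "('a::real_normed_vector \<Rightarrow> 'b::real_normed_vector set) \<Rightarrow> 'a \<Rightarrow> 'b \<Rightarrow> 'a set \<Rightarrow> bool" where
  "inner_calm_at S ybar xbar \<Omega> \<longleftrightarrow>
    xbar \<in> S ybar \<and>
    (\<exists>\<kappa>>0. \<forall>y :: nat \<Rightarrow> 'a. (\<forall>k. y k \<in> \<Omega>) \<and> y \<longlonglongrightarrow> ybar \<longrightarrow>
      (\<exists>x :: nat \<Rightarrow> 'b. \<forall>\<^sub>F k in sequentially.
         x k \<in> S (y k) \<and> norm (x k - xbar) \<le> \<kappa> * norm (y k - ybar)))"

definition inner_calm_star_fuzzy_at ::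
    "('a::real_normed_vector \<Rightarrow> 'b::real_normed_vector set) \<Rightarrow> 'a \<Rightarrow> 'a set \<Rightarrow> bool" where
  "inner_calm_star_fuzzy_at S ybar \<Omega> \<longleftrightarrow>
    (\<forall>v. norm v = 1 \<longrightarrow>
      v \<notin> tangent_cone \<Omega> ybar \<or>
      (\<exists>\<kappa>>0. \<exists>(t :: nat \<Rightarrow> real) (vs :: nat \<Rightarrow> 'a) (y :: nat \<Rightarrow> 'a) (x :: nat \<Rightarrow> 'b) xbar.
         (\<forall>k. t k > 0) \<and> t \<longlonglongrightarrow> 0 \<and> vs \<longlonglongrightarrow> v \<and>
         (\<forall>k. y k = ybar + t k *\<^sub>R vs k \<and> y k \<in> \<Omega> \<and> x k \<in> S (y k) \<and>
              norm (x k - xbar) \<le> \<kappa> * norm (y k - ybar))))"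

end

theory Submission
  imports Defs
begin

text \<open>
  All three estimates come from one compactness argument. Given \<open>t\<^sub>k \<down> 0\<close> and points
  \<open>x\<^sub>k \<in> C\<close>, consider the two difference quotients \<open>(x\<^sub>k - xbar) / t\<^sub>k\<close> and
  \<open>(\<phi> x\<^sub>k - \<phi> xbar) / t\<^sub>k\<close> at a base point \<open>xbar\<close>. If both stay bounded, they converge
  along a common subsequence to some \<open>u\<close> and \<open>v\<close>, and then at once \<open>u\<close> is tangent to \<open>C\<close>,
  \<open>v\<close> is tangent to \<open>\<phi> ` C\<close> and \<open>(u, v)\<close> is tangent to the graph of \<open>\<phi>\<close>
  (lemma \<open>bounded_quotients_subseq_tangent\<close>).

  Each hypothesis supplies the bound on the quotient that is not known to converge. Starting
  from \<open>u\<close> in the tangent cone of \<open>C\<close>, the first quotients converge and calmness of \<open>\<phi>\<close> bounds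
  the second. Starting from \<open>v\<close> in the tangent cone of \<open>Q = \<phi> ` C\<close>, the second
  quotients converge, and inner calmness provides preimages \<open>x\<^sub>k\<close> whose first quotients are
  bounded. Inner calmness* in the fuzzy sense does this only for some sequence approaching from
  a unit direction, with a base point that depends on the direction: the base point is recovered
  as the limit of the \<open>x\<^sub>k\<close>, which lies in \<open>C\<close> by closedness and is mapped to the given point of \<open>Q\<close> by
  continuity, and an arbitrary nonzero \<open>v\<close> is reached because tangent cones are cones.
\<close>

section \<open>Tangent cones\<close>

lemma tangent_coneI_eventually:
  fixes t :: "nat \<Rightarrow> real"
  assumes "\<And>k. t k > 0" "t \<longlonglongrightarrow> 0" "ws \<longlonglongrightarrow> w"
    and "\<forall>\<^sub>F k in sequentially. zbar + t k *\<^sub>R ws k \<in> \<Omega>"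
  shows "w \<in> tangent_cone \<Omega> zbar"
proof -
  obtain N where N: "\<And>k. k \<ge> N \<Longrightarrow> zbar + t k *\<^sub>R ws k \<in> \<Omega>"
    using assms(4) by (auto simp: eventually_sequentially)
  have "(\<lambda>k. t (k + N)) \<longlonglongrightarrow> 0" "(\<lambda>k. ws (k + N)) \<longlonglongrightarrow> w"
    using assms(2,3) by (auto intro: LIMSEQ_ignore_initial_segment)
  moreover have "\<forall>k. t (k + N) > 0" "\<forall>k. zbar + t (k + N) *\<^sub>R ws (k + N) \<in> \<Omega>"
    using assms(1) N by auto
  ultimately show ?thesis
    unfolding tangent_cone_def by (intro CollectI exI conjI) assumption+
qed

lemma tangent_cone_scaleR:
  assumes "w \<in> tangent_cone \<Omega> zbar" "c > 0"
  shows "c *\<^sub>R w \<in> tangent_cone \<Omega> zbar"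
proof -
  obtain t ws where *: "\<And>k. t k > 0" "t \<longlonglongrightarrow> 0" "ws \<longlonglongrightarrow> w" "\<And>k. zbar + t k *\<^sub>R ws k \<in> \<Omega>"
    using assms(1) unfolding tangent_cone_def by auto
  have "(\<lambda>k. t k / c) \<longlonglongrightarrow> 0"
    using tendsto_divide[OF *(2) tendsto_const[of c]] assms(2) by simp
  moreover have "(\<lambda>k. c *\<^sub>R ws k) \<longlonglongrightarrow> c *\<^sub>R w"
    by (intro tendsto_intros *(3))
  ultimately show ?thesis
    using *(1,4) assms(2)
    by (intro tangent_coneI_eventually[of "\<lambda>k. t k / c" "\<lambda>k. c *\<^sub>R ws k"]) auto
qed

lemma zero_in_tangent_cone:
  assumes "zbar \<in> \<Omega>"
  shows "0 \<in> tangent_cone \<Omega> zbar"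
  using assms
  by (intro tangent_coneI_eventually[OF _ LIMSEQ_inverse_real_of_nat tendsto_const]) auto

lemma graphical_derivative_scaleR:
  assumes "v \<in> graphical_derivative \<phi> xbar u" "c > 0"
  shows "c *\<^sub>R v \<in> graphical_derivative \<phi> xbar (c *\<^sub>R u)"
  using tangent_cone_scaleR[of "(u, v)"] assms unfolding graphical_derivative_def by auto

section \<open>Tangents from bounded difference quotients\<close>

text \<open>
  Applying the Bolzano--Weierstrass theorem to the pair of quotients gives one subsequence along
  which both converge. That it also selects from \<open>t\<close> is what makes the pair of limits
  tangent to the graph, rather than just each limit tangent to its own set.
\<close>

lemma bounded_quotients_subseq_tangent:
  fixes \<phi> :: "'a::euclidean_space \<Rightarrow> 'b::euclidean_space"
  assumes t: "\<And>k. t k > 0" "t \<longlonglongrightarrow> 0"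
    and C: "\<forall>\<^sub>F k in sequentially. x k \<in> C"
    and bdd_x: "\<forall>\<^sub>F k in sequentially. norm ((x k - xbar) /\<^sub>R t k) \<le> B"
    and bdd_\<phi>: "\<forall>\<^sub>F k in sequentially. norm ((\<phi> (x k) - \<phi> xbar) /\<^sub>R t k) \<le> B'"
  obtains r u v where "strict_mono (r :: nat \<Rightarrow> nat)"
    and "(\<lambda>k. (x (r k) - xbar) /\<^sub>R t (r k)) \<longlonglongrightarrow> u"
    and "(\<lambda>k. (\<phi> (x (r k)) - \<phi> xbar) /\<^sub>R t (r k)) \<longlonglongrightarrow> v"
    and "u \<in> tangent_cone C xbar"
    and "v \<in> tangent_cone (\<phi> ` C) (\<phi> xbar)"
    and "v \<in> graphical_derivative \<phi> xbar u"
proof -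
  define p where "p k = (x k - xbar) /\<^sub>R t k" for k
  define q where "q k = (\<phi> (x k) - \<phi> xbar) /\<^sub>R t k" for k
  have "\<forall>\<^sub>F k in sequentially. x k \<in> C \<and> norm (p k) \<le> B \<and> norm (q k) \<le> B'"
    using C bdd_x bdd_\<phi> unfolding p_def q_def by (intro eventually_conj)
  then obtain N where N: "\<And>k. k \<ge> N \<Longrightarrow> x k \<in> C \<and> norm (p k) \<le> B \<and> norm (q k) \<le> B'"
    by (auto simp: eventually_sequentially)
  have "(p (k + N), q (k + N)) \<in> cball 0 B \<times> cball 0 B'" for k
    using N[of "k + N"] by auto
  moreover have "compact (cball (0::'a) B \<times> cball (0::'b) B')"
    by (intro compact_Times compact_cball)
  ultimately obtain l s where s: "strict_mono (s :: nat \<Rightarrow> nat)"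
    and lim: "((\<lambda>k. (p (k + N), q (k + N))) \<circ> s) \<longlonglongrightarrow> l"
    unfolding compact_def by meson
  define r where "r k = s k + N" for k
  have r: "strict_mono r" "\<And>k. r k \<ge> N"
    using s by (auto simp: strict_mono_def r_def)
  have lim_p: "(\<lambda>k. p (r k)) \<longlonglongrightarrow> fst l" and lim_q: "(\<lambda>k. q (r k)) \<longlonglongrightarrow> snd l"
    using tendsto_fst[OF lim] tendsto_snd[OF lim] by (simp_all add: o_def r_def)
  have tr: "\<And>k. t (r k) > 0" "(\<lambda>k. t (r k)) \<longlonglongrightarrow> 0"
    using t LIMSEQ_subseq_LIMSEQ[OF t(2) r(1)] by (auto simp: o_def)
  have tp: "xbar + t k *\<^sub>R p k = x k" and tq: "\<phi> xbar + t k *\<^sub>R q k = \<phi> (x k)" for k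
    using t(1)[of k] by (simp_all add: p_def q_def)
  have "fst l \<in> tangent_cone C xbar"
    using N r(2) by (intro tangent_coneI_eventually[OF tr lim_p]) (simp add: tp)
  moreover have "snd l \<in> tangent_cone (\<phi> ` C) (\<phi> xbar)"
    using N r(2) by (intro tangent_coneI_eventually[OF tr lim_q]) (simp add: tq)
  moreover have "snd l \<in> graphical_derivative \<phi> xbar (fst l)"
    unfolding graphical_derivative_def mem_Collect_eq
    by (intro tangent_coneI_eventually[OF tr tendsto_Pair[OF lim_p lim_q]])
       (simp add: tp tq fun_graph_def)
  ultimately show ?thesis
    using that[OF r(1)] lim_p lim_q unfolding p_def q_def by blast
qed

section \<open>Forward and backward estimates\<close>

text \<open>
  Calmness turns the bound on the quotients of the points, which holds because they converge,
  into a bound on the quotients of the values.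
\<close>

lemma tangent_cone_image_calm:
  fixes \<phi> :: "'a::euclidean_space \<Rightarrow> 'b::euclidean_space"
  assumes "calm_at \<phi> xbar" "u \<in> tangent_cone C xbar"
  shows "\<exists>v \<in> tangent_cone (\<phi> ` C) (\<phi> xbar). v \<in> graphical_derivative \<phi> xbar u"
proof -
  obtain t us where t: "\<And>k. t k > 0" "t \<longlonglongrightarrow> 0" and us: "us \<longlonglongrightarrow> u"
    and C: "\<And>k. xbar + t k *\<^sub>R us k \<in> C"
    using assms(2) unfolding tangent_cone_def by auto
  define x where "x k = xbar + t k *\<^sub>R us k" for k
  have quot: "(x k - xbar) /\<^sub>R t k = us k" for k
    using t(1)[of k] by (simp add: x_def)
  have "x \<longlonglongrightarrow> xbar + 0 *\<^sub>R u"
    unfolding x_def by (intro tendsto_intros t us)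
  then have x: "x \<longlonglongrightarrow> xbar" by simp
  obtain \<kappa> where \<kappa>: "\<kappa> > 0"
    and calm: "\<forall>\<^sub>F z in nhds xbar. norm (\<phi> z - \<phi> xbar) \<le> \<kappa> * norm (z - xbar)"
    using assms(1) unfolding calm_at_def by auto
  obtain B where B: "\<And>k. norm (us k) \<le> B"
    using us convergent_imp_Bseq convergentI by (metis BseqE)
  have bdd_\<phi>: "\<forall>\<^sub>F k in sequentially. norm ((\<phi> (x k) - \<phi> xbar) /\<^sub>R t k) \<le> \<kappa> * B"
    using eventually_compose_filterlim[OF calm x]
  proof eventually_elim
    case (elim k)
    have "norm ((\<phi> (x k) - \<phi> xbar) /\<^sub>R t k) \<le> \<kappa> * norm ((x k - xbar) /\<^sub>R t k)"
      using mult_left_mono[OF elim, of "inverse (t k)"] t(1)[of k] by (simp add: mult_ac)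
    also have "\<dots> \<le> \<kappa> * B"
      using B[of k] \<kappa> by (simp add: quot)
    finally show ?case .
  qed
  have x_C: "\<forall>\<^sub>F k in sequentially. x k \<in> C"
    and bdd_x: "\<forall>\<^sub>F k in sequentially. norm ((x k - xbar) /\<^sub>R t k) \<le> B"
    using C B unfolding quot by (simp_all add: x_def)
  obtain r u' v where r: "strict_mono (r :: nat \<Rightarrow> nat)"
    and u': "(\<lambda>k. (x (r k) - xbar) /\<^sub>R t (r k)) \<longlonglongrightarrow> u'"
    and v: "v \<in> tangent_cone (\<phi> ` C) (\<phi> xbar)" "v \<in> graphical_derivative \<phi> xbar u'"
    using bounded_quotients_subseq_tangent[OF t x_C bdd_x bdd_\<phi>] by blast
  have "u' = u"
    using LIMSEQ_unique[OF u'] LIMSEQ_subseq_LIMSEQ[OF us r] by (simp add: quot o_def)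
  with v show ?thesis by blast
qed

text \<open>
  Here the values converge at a linear rate in the direction \<open>v\<close>, and the linear bound on their
  preimages is what both notions of inner calmness provide.
\<close>

lemma tangent_preimage_of_linear_bound:
  fixes \<phi> :: "'a::euclidean_space \<Rightarrow> 'b::euclidean_space"
  assumes t: "\<And>k. t k > 0" "t \<longlonglongrightarrow> 0" and vs: "vs \<longlonglongrightarrow> v" and \<kappa>: "\<kappa> > 0"
    and x: "\<forall>\<^sub>F k in sequentially. x k \<in> C \<and> \<phi> (x k) = \<phi> xbar + t k *\<^sub>R vs k \<and>
              norm (x k - xbar) \<le> \<kappa> * norm (t k *\<^sub>R vs k)"
  shows "\<exists>u \<in> tangent_cone C xbar. v \<in> graphical_derivative \<phi> xbar u"
proof -
  obtain B where B: "\<And>k. norm (vs k) \<le> B"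
    using vs convergent_imp_Bseq convergentI by (metis BseqE)
  have quot: "\<forall>\<^sub>F k in sequentially. (\<phi> (x k) - \<phi> xbar) /\<^sub>R t k = vs k"
    using x
  proof eventually_elim
    case (elim k)
    then show ?case using t(1)[of k] by simp
  qed
  have C: "\<forall>\<^sub>F k in sequentially. x k \<in> C"
    using x by eventually_elim simp
  have bdd_x: "\<forall>\<^sub>F k in sequentially. norm ((x k - xbar) /\<^sub>R t k) \<le> \<kappa> * B"
    using x
  proof eventually_elim
    case (elim k)
    then have "norm ((x k - xbar) /\<^sub>R t k) \<le> inverse (t k) * (\<kappa> * norm (t k *\<^sub>R vs k))"
      using t(1)[of k] by simp
    also have "\<dots> = \<kappa> * norm (vs k)"
      using t(1)[of k] by simp
    also have "\<dots> \<le> \<kappa> * B"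
      using B[of k] \<kappa> by simp
    finally show ?case .
  qed
  have bdd_\<phi>: "\<forall>\<^sub>F k in sequentially. norm ((\<phi> (x k) - \<phi> xbar) /\<^sub>R t k) \<le> B"
    using quot by eventually_elim (simp only: B)
  obtain r u v' where r: "strict_mono (r :: nat \<Rightarrow> nat)"
    and v': "(\<lambda>k. (\<phi> (x (r k)) - \<phi> xbar) /\<^sub>R t (r k)) \<longlonglongrightarrow> v'"
    and u: "u \<in> tangent_cone C xbar" "v' \<in> graphical_derivative \<phi> xbar u"
    using bounded_quotients_subseq_tangent[OF t C bdd_x bdd_\<phi>] by blast
  have "(\<lambda>k. (\<phi> (x k) - \<phi> xbar) /\<^sub>R t k) \<longlonglongrightarrow> v"
    using vs by (simp add: tendsto_cong[OF quot])
  then have "v' = v"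
    using LIMSEQ_unique[OF v'] LIMSEQ_subseq_LIMSEQ[OF _ r] by (fastforce simp: o_def)
  with u show ?thesis by blast
qed

section \<open>Inner calmness of the constrained preimage map\<close>

lemma sv_dom_constrained_preimage: "sv_dom (\<lambda>y. \<phi> -` {y} \<inter> C) = \<phi> ` C"
  by (auto simp: sv_dom_def)

lemma tangent_cone_image_inner_calm:
  fixes \<phi> :: "'a::euclidean_space \<Rightarrow> 'b::euclidean_space"
  assumes calm: "inner_calm_at (\<lambda>y. \<phi> -` {y} \<inter> C) ybar xbar (\<phi> ` C)"
    and v: "v \<in> tangent_cone (\<phi> ` C) ybar"
  shows "\<exists>u \<in> tangent_cone C xbar. v \<in> graphical_derivative \<phi> xbar u"
proof -
  obtain t vs where t: "\<And>k. t k > 0" "t \<longlonglongrightarrow> 0" and vs: "vs \<longlonglongrightarrow> v"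
    and y: "\<And>k. ybar + t k *\<^sub>R vs k \<in> \<phi> ` C"
    using v unfolding tangent_cone_def by auto
  have "(\<lambda>k. ybar + t k *\<^sub>R vs k) \<longlonglongrightarrow> ybar + 0 *\<^sub>R v"
    by (intro tendsto_intros t vs)
  then have lim: "(\<lambda>k. ybar + t k *\<^sub>R vs k) \<longlonglongrightarrow> ybar" by simp
  have ybar: "ybar = \<phi> xbar"
    using calm by (auto simp: inner_calm_at_def)
  obtain \<kappa> where \<kappa>: "\<kappa> > 0" and \<kappa>_seq: "\<And>y. (\<forall>k. y k \<in> \<phi> ` C) \<and> y \<longlonglongrightarrow> ybar \<Longrightarrow>
      \<exists>x. \<forall>\<^sub>F k in sequentially. x k \<in> \<phi> -` {y k} \<inter> C \<and>
        norm (x k - xbar) \<le> \<kappa> * norm (y k - ybar)"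
    using calm unfolding inner_calm_at_def by blast
  obtain x where "\<forall>\<^sub>F k in sequentially. x k \<in> \<phi> -` {ybar + t k *\<^sub>R vs k} \<inter> C \<and>
      norm (x k - xbar) \<le> \<kappa> * norm (ybar + t k *\<^sub>R vs k - ybar)"
    using \<kappa>_seq[of "\<lambda>k. ybar + t k *\<^sub>R vs k"] y lim by blast
  then have "\<forall>\<^sub>F k in sequentially. x k \<in> C \<and> \<phi> (x k) = \<phi> xbar + t k *\<^sub>R vs k \<and>
      norm (x k - xbar) \<le> \<kappa> * norm (t k *\<^sub>R vs k)"
    by eventually_elim (auto simp: ybar)
  from tangent_preimage_of_linear_bound[OF t vs \<kappa> this] show ?thesis .
qed

text \<open>
  The fuzzy notion delivers a base point without locating it: the linear bound
  forces \<open>x\<^sub>k\<close> to converge to it, so closedness and continuity put it into the fibre. The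
  notion speaks about unit directions only, hence the normalisation, and the zero direction is
  covered by the zero tangent at any point of the fibre.
\<close>

lemma tangent_cone_image_inner_calm_star_fuzzy:
  fixes \<phi> :: "'a::euclidean_space \<Rightarrow> 'b::euclidean_space"
  assumes C: "closed C" and \<phi>: "continuous_on C \<phi>" and ybar: "ybar \<in> \<phi> ` C"
    and calm: "inner_calm_star_fuzzy_at (\<lambda>y. \<phi> -` {y} \<inter> C) ybar (\<phi> ` C)"
    and v: "v \<in> tangent_cone (\<phi> ` C) ybar"
  shows "\<exists>xbar \<in> \<phi> -` {ybar} \<inter> C. \<exists>u \<in> tangent_cone C xbar. v \<in> graphical_derivative \<phi> xbar u"
proof (cases "v = 0")
  case True
  obtain xbar where xbar: "xbar \<in> C" "ybar = \<phi> xbar" using ybar by auto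
  have "v \<in> graphical_derivative \<phi> xbar 0"
    using zero_in_tangent_cone[of "(xbar, \<phi> xbar)" "fun_graph \<phi>"] True
    by (simp add: graphical_derivative_def fun_graph_def zero_prod_def)
  with xbar zero_in_tangent_cone[OF xbar(1)] show ?thesis by auto
next
  case False
  define w where "w = v /\<^sub>R norm v"
  have w: "norm w = 1" "w \<in> tangent_cone (\<phi> ` C) ybar" "v = norm v *\<^sub>R w"
    using False tangent_cone_scaleR[OF v] by (auto simp: w_def)
  obtain \<kappa> t vs x xbar where \<kappa>: "\<kappa> > 0" and t: "\<And>k. t k > 0" "t \<longlonglongrightarrow> 0"
    and vs: "vs \<longlonglongrightarrow> w"
    and x: "\<And>k. x k \<in> C" "\<And>k. \<phi> (x k) = ybar + t k *\<^sub>R vs k"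
    and bound: "\<And>k. norm (x k - xbar) \<le> \<kappa> * norm (t k *\<^sub>R vs k)"
  proof -
    obtain \<kappa> t vs y x xbar where \<kappa>: "\<kappa> > 0"
      and t: "\<forall>k. t k > 0" "t \<longlonglongrightarrow> 0" and vs: "vs \<longlonglongrightarrow> w"
      and *: "\<forall>k. y k = ybar + t k *\<^sub>R vs k \<and> y k \<in> \<phi> ` C \<and> x k \<in> \<phi> -` {y k} \<inter> C \<and>
              norm (x k - xbar) \<le> \<kappa> * norm (y k - ybar)"
      using calm w(1,2) unfolding inner_calm_star_fuzzy_at_def by blast
    have x: "x k \<in> C" "\<phi> (x k) = ybar + t k *\<^sub>R vs k" for k
      using *[rule_format, of k] by simp_all
    have bound: "norm (x k - xbar) \<le> \<kappa> * norm (t k *\<^sub>R vs k)" for k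
    proof -
      have eq: "t k *\<^sub>R vs k = y k - ybar" using *[rule_format, of k] by simp
      show ?thesis unfolding eq using *[rule_format, of k] by (elim conjE)
    qed
    show ?thesis
      by (rule that[OF \<kappa> spec[OF t(1)] t(2) vs x bound])
  qed
  have "(\<lambda>k. \<kappa> * norm (t k *\<^sub>R vs k)) \<longlonglongrightarrow> \<kappa> * norm (0 *\<^sub>R w)"
    by (intro tendsto_intros t vs)
  then have "(\<lambda>k. x k - xbar) \<longlonglongrightarrow> 0"
    using Lim_null_comparison[OF always_eventually[OF allI[OF bound]]] by simp
  then have x_lim: "x \<longlonglongrightarrow> xbar"
    by (simp add: LIM_zero_iff)
  have xbar: "xbar \<in> C"
    using closed_sequentially[OF C] x(1) x_lim by blast
  have "(\<lambda>k. ybar + t k *\<^sub>R vs k) \<longlonglongrightarrow> \<phi> xbar"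
    using continuous_on_tendsto_compose[OF \<phi> x_lim xbar] x by simp
  moreover have "(\<lambda>k. ybar + t k *\<^sub>R vs k) \<longlonglongrightarrow> ybar + 0 *\<^sub>R w"
    by (intro tendsto_intros t vs)
  ultimately have fibre: "\<phi> xbar = ybar"
    using LIMSEQ_unique by fastforce
  have "\<exists>u \<in> tangent_cone C xbar. w \<in> graphical_derivative \<phi> xbar u"
    using x bound
    by (intro tangent_preimage_of_linear_bound[OF t vs \<kappa>, where x = x]) (simp add: fibre)
  then obtain u where "u \<in> tangent_cone C xbar" "w \<in> graphical_derivative \<phi> xbar u"
    by blast
  then have "norm v *\<^sub>R u \<in> tangent_cone C xbar"
    "norm v *\<^sub>R w \<in> graphical_derivative \<phi> xbar (norm v *\<^sub>R u)"
    using False by (simp_all add: tangent_cone_scaleR graphical_derivative_scaleR)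
  with xbar fibre show ?thesis
    unfolding w(3)[symmetric] by blast
qed

section \<open>Tangent cones to images\<close>

theorem theorem4p1:
  fixes C :: "(real ^ 'n) set"
    and \<phi> :: "real ^ 'n \<Rightarrow> real ^ 'l"
    and Q :: "(real ^ 'l) set"
    and ybar :: "real ^ 'l"
    and \<Psi> :: "real ^ 'l \<Rightarrow> (real ^ 'n) set"
  assumes "closed C"
    and "continuous_on UNIV \<phi>"
    and "Q = \<phi> ` C"
    and "ybar \<in> Q"
    and "\<And>y. \<Psi> y = \<phi> -` {y} \<inter> C"
    and "inner_semicompact_at \<Psi> ybar (sv_dom \<Psi>)"
  shows "(\<forall>xbar \<in> \<Psi> ybar. calm_at \<phi> xbar \<longrightarrow>
            tangent_cone C xbar
              \<subseteq> {u. \<exists>v \<in> tangent_cone Q ybar. v \<in> graphical_derivative \<phi> xbar u})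
       \<and> (inner_calm_star_fuzzy_at \<Psi> ybar (sv_dom \<Psi>) \<longrightarrow>
            tangent_cone Q ybar
              \<subseteq> (\<Union>xbar \<in> \<Psi> ybar.
                    {v. \<exists>u \<in> tangent_cone C xbar. v \<in> graphical_derivative \<phi> xbar u}))
       \<and> (\<forall>xbar \<in> \<Psi> ybar. inner_calm_at \<Psi> ybar xbar (sv_dom \<Psi>) \<longrightarrow>
            tangent_cone Q ybar
              \<subseteq> {v. \<exists>u \<in> tangent_cone C xbar. v \<in> graphical_derivative \<phi> xbar u})"
proof -
  have \<Psi>: "\<Psi> = (\<lambda>y. \<phi> -` {y} \<inter> C)" and Q: "Q = \<phi> ` C"
    using assms(3,5) by auto
  have dom: "sv_dom \<Psi> = \<phi> ` C"
    unfolding \<Psi> by (rule sv_dom_constrained_preimage)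
  have \<phi>: "continuous_on C \<phi>"
    using assms(2) continuous_on_subset by blast
  show ?thesis
    unfolding dom unfolding \<Psi> Q
  proof (intro conjI ballI impI subsetI)
    fix xbar u
    assume "xbar \<in> \<phi> -` {ybar} \<inter> C" "calm_at \<phi> xbar" "u \<in> tangent_cone C xbar"
    then show "u \<in> {u. \<exists>v \<in> tangent_cone (\<phi> ` C) ybar. v \<in> graphical_derivative \<phi> xbar u}"
      using tangent_cone_image_calm[of \<phi> xbar u C] by auto
  next
    fix v
    assume "inner_calm_star_fuzzy_at (\<lambda>y. \<phi> -` {y} \<inter> C) ybar (\<phi> ` C)"
      "v \<in> tangent_cone (\<phi> ` C) ybar"
    then show "v \<in> (\<Union>xbar \<in> \<phi> -` {ybar} \<inter> C.
        {v. \<exists>u \<in> tangent_cone C xbar. v \<in> graphical_derivative \<phi> xbar u})"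
      using tangent_cone_image_inner_calm_star_fuzzy[OF assms(1) \<phi>, of ybar v] assms(4) Q
      by simp
  next
    fix xbar v
    assume "inner_calm_at (\<lambda>y. \<phi> -` {y} \<inter> C) ybar xbar (\<phi> ` C)"
      "v \<in> tangent_cone (\<phi> ` C) ybar"
    then show "v \<in> {v. \<exists>u \<in> tangent_cone C xbar. v \<in> graphical_derivative \<phi> xbar u}"
      using tangent_cone_image_inner_calm[of \<phi> C ybar xbar v] by simp
  qed
qed

end
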